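(* Let $I$ be a composition. The number of sylvester classes of words of evaluation $I$ is $$\sum_{J\le\overline{I}}\langle M_J,g\rangle,$$ where $\langle\cdot,\cdot\rangle$ is the duality bracket between $QSym$ and $\mathbf{Sym}$.
   Context: The sylvester congruence is the congruence on the free monoid $A^*$ over a totally ordered alphabet $A$ (identified with the positive integers) generated by the relations $ac\,v\,b\equiv ca\,v\,b$ for letters $a\le b<c$ and any word $v$. A word has evaluation $I=(i_1,\dots,i_r)$ if it contains exactly $i_k$ letters $k$ for $1\le k\le r$ and no other letter; a sylvester class consists of words of the same evaluation. $\overline{I}=(i_r,\dots,i_1)$ is the mirror image of $I$. For compositions of the same integer, $J\le I$ means that $J$ is coarser than or equal to $I$ (obtained from $I$ by summing consecutive parts). $\mathbf{Sym}$ is the Hopf algebra of noncommutative symmetric functions, freely generated by the complete functions $S_n$, $n\ge1$ ($S_0=1$), with basis $S^I=S_{i_1}\cdots S_{i_r}$; the monomial quasi-symmetric functions $M_I\in QSym$ form the dual basis of $S^I$: $\langle M_I,S^J\rangle=\delta_{IJ}$. $g$ is the unique series in (the completion of) $\mathbf{Sym}$ satisfying the functional equation $g=\sum_{n\ge0}S_n g^n$; so $\langle M_J,g\rangle$ is the coefficient of $S^J$ in $g$. *)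

theory Defs
  imports Complex_Main "HOL-Library.Poly_Mapping"
begin

section \<open>Words and the sylvester congruence\<close>

text \<open>The totally ordered alphabet is the type of letters; words are lists.\<close>

inductive sylvester :: "'a::linorder list \<Rightarrow> 'a list \<Rightarrow> bool" where
  sylvester_gen: "a \<le> b \<Longrightarrow> b < c \<Longrightarrow> sylvester ([a, c] @ v @ [b]) ([c, a] @ v @ [b])"
| sylvester_refl: "sylvester w w"
| sylvester_sym: "sylvester u w \<Longrightarrow> sylvester w u"
| sylvester_trans: "sylvester u v \<Longrightarrow> sylvester v w \<Longrightarrow> sylvester u w"
| sylvester_append: "sylvester u u' \<Longrightarrow> sylvester w w' \<Longrightarrow> sylvester (u @ w) (u' @ w')"

definition composition :: "nat list \<Rightarrow> bool" where
  "composition I \<longleftrightarrow> (\<forall>i\<in>set I. 0 < i)"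

text \<open>Letter \<open>k\<close> (counted from 1) corresponds to the list index \<open>k - 1\<close> of the evaluation.
  Words of a given evaluation only contain positive letters, and the generating relations permute
  letters, so it is immaterial that the type of letters also contains 0.\<close>

definition has_evaluation :: "nat list \<Rightarrow> nat list \<Rightarrow> bool" where
  "has_evaluation w I \<longleftrightarrow>
     set w \<subseteq> {1..length I} \<and> (\<forall>k\<in>{1..length I}. count_list w k = I ! (k - 1))"

definition sylvester_classes :: "nat list \<Rightarrow> nat list set set" where
  "sylvester_classes I = {w. has_evaluation w I} // {(u, w). sylvester u w}"

text \<open>\<open>coarser J I\<close>: cut \<open>I\<close> into nonempty blocks of consecutive parts and sum each block.\<close>

definition coarser :: "nat list \<Rightarrow> nat list \<Rightarrow> bool" where
  "coarser J I \<longleftrightarrow> (\<exists>Bs. [] \<notin> set Bs \<and> concat Bs = I \<and> J = map sum_list Bs)"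

lemma coarser_refl: "coarser I I"
proof -
  have "concat (map (\<lambda>i. [i]) I) = I" "map sum_list (map (\<lambda>i. [i]) I) = I"
    by (induction I) simp_all
  then show ?thesis
    unfolding coarser_def by (intro exI[of _ "map (\<lambda>i. [i]) I"]) auto
qed

lemma finite_coarser: "finite {J. coarser J I}"
proof (rule finite_subset)
  show "{J. coarser J I} \<subseteq> {J. set J \<subseteq> {..sum_list I} \<and> length J \<le> length I}"
  proof clarify
    fix J assume "coarser J I"
    then obtain Bs where Bs: "[] \<notin> set Bs" "concat Bs = I" "J = map sum_list Bs"
      unfolding coarser_def by blast
    have "[] \<notin> set Bs \<Longrightarrow> length Bs \<le> length (concat Bs)"
    proof (induction Bs)
      case (Cons B Bs)
      then show ?case by (cases B) auto
    qed simp
    moreover have "sum_list B \<le> sum_list (concat Bs)" if "B \<in> set Bs" for B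
      using that by (induction Bs) (auto simp: trans_le_add2)
    ultimately show "set J \<subseteq> {..sum_list I} \<and> length J \<le> length I"
      using Bs by auto
  qed
qed (rule finite_lists_length_le, simp)

section \<open>Noncommutative symmetric functions\<close>

text \<open>Elements of the completion of \<open>Sym\<close> are arbitrary formal linear combinations of the
  products of complete functions \<open>S^I\<close>, stored as the family of their coefficients on the
  \<open>S^I\<close>; these multiply by \<open>S^I S^J = S^(I @ J)\<close>.\<close>

typedef (overloaded) 'a nsym = "{f :: nat list \<Rightarrow> 'a::zero. \<forall>J. \<not> composition J \<longrightarrow> f J = 0}"
  morphisms nsym_coeff Abs_nsym
  by (rule exI[of _ "\<lambda>_. 0"]) simp

setup_lifting type_definition_nsym

lemma nsym_eqI: "(\<And>J. composition J \<Longrightarrow> nsym_coeff F J = nsym_coeff G J) \<Longrightarrow> F = G"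
  by transfer (metis ext)

lemma composition_append: "composition (I @ J) \<longleftrightarrow> composition I \<and> composition J"
  by (auto simp: composition_def)

instantiation nsym :: (comm_ring_1) ring_1
begin

lift_definition zero_nsym :: "'a nsym" is "\<lambda>_. 0" by simp
lift_definition one_nsym :: "'a nsym" is "\<lambda>J. if J = [] then 1 else 0"
  by (auto simp: composition_def)
lift_definition plus_nsym :: "'a nsym \<Rightarrow> 'a nsym \<Rightarrow> 'a nsym" is "\<lambda>f g J. f J + g J" by simp
lift_definition minus_nsym :: "'a nsym \<Rightarrow> 'a nsym \<Rightarrow> 'a nsym" is "\<lambda>f g J. f J - g J" by simp
lift_definition uminus_nsym :: "'a nsym \<Rightarrow> 'a nsym" is "\<lambda>f J. - f J" by simp
lift_definition times_nsym :: "'a nsym \<Rightarrow> 'a nsym \<Rightarrow> 'a nsym"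
  is "\<lambda>f g J. \<Sum>k\<le>length J. f (take k J) * g (drop k J)"
  by (intro allI impI sum.neutral ballI) (metis append_take_drop_id composition_append mult_zero_left mult_zero_right)

instance
proof
  fix a b c :: "'a nsym"
  have assoc: "(\<Sum>j\<le>k. \<Sum>i\<le>j. p i (j - i) (n - j)) = (\<Sum>j\<le>k. \<Sum>i\<le>k - j. p j i (n - j - i))"
    for k n :: nat and p :: "nat \<Rightarrow> nat \<Rightarrow> nat \<Rightarrow> 'a"
    by (induct k) (simp_all add: Suc_diff_le sum.distrib add.assoc)
  show "a * b * c = a * (b * c)"
  proof (rule nsym_eqI)
    fix J :: "nat list"
    define f g h where "f = nsym_coeff a" and "g = nsym_coeff b" and "h = nsym_coeff c"
    define p where "p = (\<lambda>i j (k::nat). f (take i J) * g (take j (drop i J)) * h (drop (length J - k) J))"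
    have "(\<Sum>k\<le>length J. (\<Sum>l\<le>length (take k J). f (take l (take k J)) * g (drop l (take k J))) * h (drop k J))
        = (\<Sum>k\<le>length J. \<Sum>l\<le>k. p l (k - l) (length J - k))"
      unfolding p_def by (intro sum.cong refl)
        (auto simp: sum_distrib_right drop_take min_def intro!: sum.cong)
    also have "\<dots> = (\<Sum>k\<le>length J. \<Sum>l\<le>length J - k. p k l (length J - k - l))"
      by (rule assoc)
    also have "\<dots> = (\<Sum>k\<le>length J. f (take k J) * (\<Sum>l\<le>length (drop k J). g (take l (drop k J)) * h (drop l (drop k J))))"
      unfolding p_def by (intro sum.cong refl)
        (auto simp: sum_distrib_left mult.assoc add.commute intro!: sum.cong)
    finally show "nsym_coeff (a * b * c) J = nsym_coeff (a * (b * c)) J"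
      by (simp only: times_nsym.rep_eq f_def g_def h_def)
  qed
  show "1 * a = a"
  proof (rule nsym_eqI)
    fix J
    show "nsym_coeff (1 * a) J = nsym_coeff a J"
      unfolding times_nsym.rep_eq one_nsym.rep_eq
      by (subst sum.remove[of _ 0]) (auto intro!: sum.neutral)
  qed
  show "a * 1 = a"
  proof (rule nsym_eqI)
    fix J
    show "nsym_coeff (a * 1) J = nsym_coeff a J"
      unfolding times_nsym.rep_eq one_nsym.rep_eq
      by (subst sum.remove[of _ "length J"]) (auto intro!: sum.neutral)
  qed
  show "(a + b) * c = a * c + b * c" by transfer (auto simp: algebra_simps sum.distrib)
  show "a * (b + c) = a * b + a * c" by transfer (auto simp: algebra_simps sum.distrib)
  show "(0 :: 'a nsym) \<noteq> 1" by transfer (metis zero_neq_one)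
qed (transfer; simp add: algebra_simps)+

end

lift_definition sym_S :: "nat \<Rightarrow> 'a::comm_ring_1 nsym" is
  "\<lambda>n J. if J = (if n = 0 then [] else [n]) then 1 else 0"
  by (auto simp: composition_def)

definition sym_S_prod :: "nat list \<Rightarrow> 'a::comm_ring_1 nsym" where
  "sym_S_prod I = prod_list (map sym_S I)"

text \<open>Convergence of a series in the completion. As there are finitely many compositions of each
  degree, convergence for the degree filtration means that every coefficient of the partial sums
  is eventually constant.\<close>

definition nsym_sums :: "(nat \<Rightarrow> 'a::comm_ring_1 nsym) \<Rightarrow> 'a nsym \<Rightarrow> bool" where
  "nsym_sums F s \<longleftrightarrow>
     (\<forall>J. \<forall>\<^sub>F N in sequentially. nsym_coeff (\<Sum>n<N. F n) J = nsym_coeff s J)"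

definition g_series :: "'a::comm_ring_1 nsym" where
  "g_series = (THE g. nsym_sums (\<lambda>n. sym_S n * g ^ n) g)"

section \<open>Quasi-symmetric functions and the duality bracket\<close>

text \<open>Formal power series of bounded degree in commuting variables indexed by \<open>nat\<close>. A monomial
  is the finitely supported function giving the exponents; its exponent composition lists the
  nonzero exponents in increasing order of the variables.\<close>

definition exponent_composition :: "(nat \<Rightarrow>\<^sub>0 nat) \<Rightarrow> nat list" where
  "exponent_composition m = map (Poly_Mapping.lookup m) (sorted_list_of_set (Poly_Mapping.keys m))"

definition quasi_symmetric :: "((nat \<Rightarrow>\<^sub>0 nat) \<Rightarrow> 'a::zero) \<Rightarrow> bool" where
  "quasi_symmetric f \<longleftrightarrow>
     (\<exists>d. \<forall>m. f m \<noteq> 0 \<longrightarrow> (\<Sum>k\<in>Poly_Mapping.keys m. Poly_Mapping.lookup m k) \<le> d) \<and>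
     (\<forall>m m'. exponent_composition m = exponent_composition m' \<longrightarrow> f m = f m')"

typedef (overloaded) 'a qsym = "{f :: (nat \<Rightarrow>\<^sub>0 nat) \<Rightarrow> 'a::zero. quasi_symmetric f}"
  morphisms qsym_coeff Abs_qsym
  by (rule exI[of _ "\<lambda>_. 0"]) (simp add: quasi_symmetric_def)

setup_lifting type_definition_qsym

lift_definition monomial_qsym :: "nat list \<Rightarrow> 'a::comm_ring_1 qsym" is
  "\<lambda>I m. if exponent_composition m = I then 1 else 0"
proof -
  fix I :: "nat list"
  have "(\<Sum>k\<in>Poly_Mapping.keys m. Poly_Mapping.lookup m k) = sum_list (exponent_composition m)" for m :: "nat \<Rightarrow>\<^sub>0 nat"
    by (simp add: exponent_composition_def sum_list_distinct_conv_sum_set)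
  then show "quasi_symmetric (\<lambda>m. if exponent_composition m = I then 1 else 0 :: 'a)"
    unfolding quasi_symmetric_def by auto
qed

text \<open>The coefficient of \<open>M_J\<close> in a quasi-symmetric function is its coefficient on any monomial
  with exponent composition \<open>J\<close>, such as \<open>x_0^(J!0) x_1^(J!1) ...\<close>. The bracket below is the
  bilinear one with \<open>\<langle>M_I, S^J\<rangle> = \<delta>\<close>; the sum is finite since quasi-symmetric functions have
  bounded degree.\<close>

definition monomial_coeff :: "'a::zero qsym \<Rightarrow> nat list \<Rightarrow> 'a" where
  "monomial_coeff F J = qsym_coeff F (Poly_Mapping.nth J)"

definition bracket :: "'a::comm_ring_1 qsym \<Rightarrow> 'a nsym \<Rightarrow> 'a" where
  "bracket F G = (\<Sum>J | composition J \<and> monomial_coeff F J \<noteq> 0. monomial_coeff F J * nsym_coeff G J)"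

lemma exponent_composition_nth:
  assumes "composition J"
  shows "exponent_composition (Poly_Mapping.nth J) = J"
proof -
  have "Poly_Mapping.keys (Poly_Mapping.nth J) = {0..<length J}"
    using assms by (auto simp: in_keys_iff nth_default_def composition_def simp del: keys_nth split: if_splits)
  then show ?thesis
    unfolding exponent_composition_def by (intro nth_equalityI) (simp_all add: nth_default_def del: keys_nth)
qed

lemma monomial_coeff_monomial_qsym:
  "composition J \<Longrightarrow> monomial_coeff (monomial_qsym I) J = (if J = I then 1 else 0)"
  unfolding monomial_coeff_def by transfer (simp add: exponent_composition_nth)

lemma bracket_monomial_qsym:
  fixes G :: "'a::comm_ring_1 nsym"
  assumes "composition I"
  shows "bracket (monomial_qsym I) G = nsym_coeff G I"
proof -
  have "{J. composition J \<and> monomial_coeff (monomial_qsym I) J \<noteq> (0::'a)} = {I}"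
    using assms by (auto simp: monomial_coeff_monomial_qsym split: if_splits)
  then show ?thesis
    unfolding bracket_def using assms by (simp only: monomial_coeff_monomial_qsym) (simp add: monomial_coeff_monomial_qsym)
qed

lemma nsym_coeff_one: "nsym_coeff 1 J = (if J = [] then 1 else 0)"
  by transfer simp

lemma nsym_coeff_times:
  "nsym_coeff (F * G) J = (\<Sum>k\<le>length J. nsym_coeff F (take k J) * nsym_coeff G (drop k J))"
  by transfer simp

lemma nsym_coeff_sym_S_times:
  assumes "n > 0"
  shows "nsym_coeff (sym_S n * G) J =
    (case J of [] \<Rightarrow> 0 | j # K \<Rightarrow> if j = n then nsym_coeff G K else 0)"
proof (cases J)
  case Nil
  then show ?thesis using assms by (simp add: nsym_coeff_times sym_S.rep_eq)
next
  case (Cons j K)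
  have eq: "take k J = [n] \<longleftrightarrow> k = 1 \<and> j = n" if "k \<le> length J" for k
    using that Cons by (cases k) auto
  have "nsym_coeff (sym_S n * G) J
      = (\<Sum>k\<le>length J. if k = 1 \<and> j = n then nsym_coeff G (drop k J) else 0)"
    unfolding nsym_coeff_times using assms
    by (intro sum.cong refl) (auto simp: sym_S.rep_eq eq)
  also have "\<dots> = (if j = n then nsym_coeff G K else 0)"
    using Cons by (cases "j = n") (simp_all add: Suc_le_eq)
  finally show ?thesis using Cons by simp
qed

lemma sym_S_0: "sym_S 0 = 1"
  by transfer simp

lemma bracket_monomial_sym_S:
  assumes "composition I" "composition J"
  shows "bracket (monomial_qsym I) (sym_S_prod J) = (if I = J then 1 else 0)"
proof -
  have "nsym_coeff (sym_S_prod J) I = (if I = J then 1 else 0)"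
    using assms(2)
  proof (induction J arbitrary: I)
    case Nil
    then show ?case by (simp add: sym_S_prod_def nsym_coeff_one)
  next
    case (Cons n J)
    then show ?case
      by (auto simp: sym_S_prod_def composition_def nsym_coeff_sym_S_times split: list.splits)
  qed
  then show ?thesis using assms by (simp add: bracket_monomial_qsym)
qed

section \<open>The series \<open>g\<close> is well defined\<close>

lemma nsym_coeff_sum: "nsym_coeff (\<Sum>n\<in>A. F n) J = (\<Sum>n\<in>A. nsym_coeff (F n) J)"
  by (induction A rule: infinite_finite_induct) (simp_all add: zero_nsym.rep_eq plus_nsym.rep_eq)

lemma nsym_sums_iff:
  fixes g h :: "'a::comm_ring_1 nsym"
  shows "nsym_sums (\<lambda>n. sym_S n * g ^ n) h \<longleftrightarrow>
    nsym_coeff h [] = 1 \<and>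
    (\<forall>n K. n > 0 \<longrightarrow> nsym_coeff h (n # K) = nsym_coeff (g ^ n) K)"
proof -
  have partial: "nsym_coeff (\<Sum>n<N. sym_S n * g ^ n) J =
      (case J of [] \<Rightarrow> 1 | j # K \<Rightarrow> if j = 0 then 0 else nsym_coeff (g ^ j) K)"
    if N: "N > sum_list J" for N J
  proof -
    have "N > 0" using N by simp
    then have "nsym_coeff (\<Sum>n<N. sym_S n * g ^ n) J =
       nsym_coeff 1 J + (\<Sum>n\<in>{..<N}-{0}. nsym_coeff (sym_S n * g ^ n) J)"
      unfolding nsym_coeff_sum by (subst sum.remove[of _ 0]) (simp_all add: sym_S_0)
    also have "(\<Sum>n\<in>{..<N}-{0}. nsym_coeff (sym_S n * g ^ n) J) =
       (\<Sum>n\<in>{..<N}-{0}. case J of [] \<Rightarrow> 0 | j # K \<Rightarrow> if n = j then nsym_coeff (g ^ j) K else 0)"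
      by (intro sum.cong refl) (auto simp: nsym_coeff_sym_S_times split: list.splits)
    also have "\<dots> = (case J of [] \<Rightarrow> 0 | j # K \<Rightarrow> if j = 0 then 0 else nsym_coeff (g ^ j) K)"
      using N by (cases J) (auto simp: sum.delta)
    finally show ?thesis
      by (cases J) (auto simp: nsym_coeff_one)
  qed
  have "(\<forall>\<^sub>F N in sequentially. nsym_coeff (\<Sum>n<N. sym_S n * g ^ n) J = nsym_coeff h J) \<longleftrightarrow>
      (case J of [] \<Rightarrow> 1 | j # K \<Rightarrow> if j = 0 then 0 else nsym_coeff (g ^ j) K) = nsym_coeff h J" for J
  proof -
    have "\<forall>\<^sub>F N in sequentially. nsym_coeff (\<Sum>n<N. sym_S n * g ^ n) J =
      (case J of [] \<Rightarrow> 1 | j # K \<Rightarrow> if j = 0 then 0 else nsym_coeff (g ^ j) K)"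
      using eventually_gt_at_top[of "sum_list J"] by eventually_elim (rule partial)
    then have "(\<forall>\<^sub>F N in sequentially. nsym_coeff (\<Sum>n<N. sym_S n * g ^ n) J = nsym_coeff h J) \<longleftrightarrow>
      (\<forall>\<^sub>F N in sequentially. (case J of [] \<Rightarrow> 1 | j # K \<Rightarrow> if j = 0 then 0 else nsym_coeff (g ^ j) K) = nsym_coeff h J)"
      by (intro eventually_subst) (auto elim!: eventually_mono)
    then show ?thesis by simp
  qed
  then have "nsym_sums (\<lambda>n. sym_S n * g ^ n) h \<longleftrightarrow>
    (\<forall>J. (case J of [] \<Rightarrow> 1 | j # K \<Rightarrow> if j = 0 then 0 else nsym_coeff (g ^ j) K) = nsym_coeff h J)"
    unfolding nsym_sums_def by simp
  also have "\<dots> \<longleftrightarrow> nsym_coeff h [] = 1 \<and>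
    (\<forall>n K. (if n = 0 then 0 else nsym_coeff (g ^ n) K) = nsym_coeff h (n # K))"
    (is "(\<forall>J. ?c J = _) \<longleftrightarrow> _")
  proof -
    have "(\<forall>J. P J) \<longleftrightarrow> P [] \<and> (\<forall>n K. P (n # K))" for P :: "nat list \<Rightarrow> bool"
      by (metis neq_Nil_conv)
    from this[of "\<lambda>J. ?c J = nsym_coeff h J"] show ?thesis
      by (simp add: eq_commute[of 1])
  qed
  also have "\<dots> \<longleftrightarrow> nsym_coeff h [] = 1 \<and>
    (\<forall>n K. n > 0 \<longrightarrow> nsym_coeff h (n # K) = nsym_coeff (g ^ n) K)"
  proof -
    have "nsym_coeff h (0 # K) = 0" for K
      using nsym_coeff[of h] by (auto simp: composition_def)
    then show ?thesis by (metis less_numeral_extra(3) not_gr_zero)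
  qed
  finally show ?thesis .
qed

lemma nsym_coeff_power_cong:
  assumes "\<And>J. length J \<le> k \<Longrightarrow> nsym_coeff F J = nsym_coeff G J" "length K \<le> k"
  shows "nsym_coeff (F ^ n) K = nsym_coeff (G ^ n) K"
  using assms(2)
proof (induction n arbitrary: K)
  case (Suc n)
  then show ?case
    unfolding power_Suc nsym_coeff_times
    by (intro sum.cong refl arg_cong2[of _ _ _ _ "(*)"] assms(1)) auto
qed simp

lemma g_series_ex1: "\<exists>!g :: 'a::comm_ring_1 nsym. nsym_sums (\<lambda>n. sym_S n * g ^ n) g"
proof (rule ex_ex1I)
  define step where "step = (\<lambda>f :: 'a nsym. Abs_nsym (\<lambda>J. case J of [] \<Rightarrow> 1
      | j # K \<Rightarrow> if j = 0 then 0 else nsym_coeff (f ^ j) K))"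
  have step: "nsym_coeff (step f) J = (case J of [] \<Rightarrow> 1
      | j # K \<Rightarrow> if j = 0 then 0 else nsym_coeff (f ^ j) K)" for f J
    unfolding step_def
  proof (subst Abs_nsym_inverse)
    show "(\<lambda>J. case J of [] \<Rightarrow> 1 | j # K \<Rightarrow> if j = 0 then 0 else nsym_coeff (f ^ j) K)
      \<in> {f. \<forall>J. \<not> composition J \<longrightarrow> f J = 0}"
      using nsym_coeff by (auto simp: composition_def split: list.splits)
  qed simp
  define h where "h = (\<lambda>k. (step ^^ k) 0)"
  have stable: "nsym_coeff (h k) J = nsym_coeff (h (Suc k)) J" if "length J < k" for k J
    using that
  proof (induction k arbitrary: J)
    case (Suc k)
    have "nsym_coeff (step (h k)) J = nsym_coeff (step (h (Suc k))) J"
    proof (cases J)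
      case (Cons j K)
      then have "k > 0" using Suc.prems by simp
      then have "nsym_coeff (h k ^ j) K = nsym_coeff (h (Suc k) ^ j) K"
        using Suc Cons by (intro nsym_coeff_power_cong[of "k - 1"]) auto
      then show ?thesis using Cons by (simp add: step)
    qed (simp add: step)
    then show ?case by (simp add: h_def)
  qed simp
  have stable': "nsym_coeff (h k) J = nsym_coeff (h (Suc (length J))) J" if "Suc (length J) \<le> k" for k J
    using that by (induction k rule: dec_induct) (auto simp: stable[symmetric])
  define g where "g = Abs_nsym (\<lambda>J. nsym_coeff (h (Suc (length J))) J)"
  have g: "nsym_coeff g J = nsym_coeff (h (Suc (length J))) J" for J
    unfolding g_def by (subst Abs_nsym_inverse) (use nsym_coeff in auto)
  have "nsym_sums (\<lambda>n. sym_S n * g ^ n) g"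
    unfolding nsym_sums_iff
  proof safe
    show "nsym_coeff g [] = 1" by (simp add: g h_def step)
    fix n :: nat and K :: "nat list" assume "n > 0"
    then have "nsym_coeff g (n # K) = nsym_coeff (h (Suc (length K)) ^ n) K"
      by (simp add: g h_def step)
    also have "\<dots> = nsym_coeff (g ^ n) K"
    proof (rule nsym_coeff_power_cong)
      fix J :: "nat list" assume "length J \<le> length K"
      then show "nsym_coeff (h (Suc (length K))) J = nsym_coeff g J"
        unfolding g by - (rule stable', simp)
    qed simp
    finally show "nsym_coeff g (n # K) = nsym_coeff (g ^ n) K" .
  qed
  then show "\<exists>g :: 'a nsym. nsym_sums (\<lambda>n. sym_S n * g ^ n) g" by blast
next
  fix g g' :: "'a nsym"
  assume g: "nsym_sums (\<lambda>n. sym_S n * g ^ n) g" and g': "nsym_sums (\<lambda>n. sym_S n * g' ^ n) g'"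
  have "\<forall>J. length J \<le> k \<longrightarrow> composition J \<longrightarrow> nsym_coeff g J = nsym_coeff g' J" for k
  proof (induction k)
    case 0
    then show ?case using g g' by (simp add: nsym_sums_iff)
  next
    case (Suc k)
    have IH: "nsym_coeff g J = nsym_coeff g' J" if "length J \<le> k" for J
      using Suc that nsym_coeff[of g] nsym_coeff[of g'] by (cases "composition J") auto
    show ?case
    proof safe
      fix J :: "nat list" assume J: "length J \<le> Suc k" "composition J"
      show "nsym_coeff g J = nsym_coeff g' J"
      proof (cases J)
        case (Cons n K)
        then have "nsym_coeff (g ^ n) K = nsym_coeff (g' ^ n) K"
          using J by (intro nsym_coeff_power_cong[of k] IH) auto
        then show ?thesis
          using g g' J Cons by (simp add: nsym_sums_iff composition_def)
      qed (use IH in simp)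
    qed
  qed
  then show "g = g'" by (intro nsym_eqI) blast
qed

end

theory Submission
  imports Defs
begin

text \<open>
  Every sylvester class contains exactly one word avoiding the pattern \<open>c \<dots> a \<dots> b\<close> with
  \<open>a \<le> b < c\<close>: this is the word obtained by reading the binary search tree of the class in
  postorder. Such words are built by inserting the letters from the largest to
  the smallest. In a word \<open>u\<close> over letters greater than \<open>a\<close>, all copies of \<open>a\<close> but the last one
  must go to the front, and the last one may go to any cut \<open>u = x @ y\<close> where no letter of \<open>x\<close>
  exceeds a letter of \<open>y\<close>. Using \<open>k\<close> copies and the \<open>m\<close>-th such cut from the right yields a word
  with \<open>k + m\<close> cuts, so the number of avoiding words is \<open>avoiding_count 1 (rev I)\<close>, where
  \<open>avoiding_count n (k # K) = (\<Sum>m=1..n. avoiding_count (k + m) K)\<close>. On the other side,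
  \<open>g ^ Suc n = g ^ n + (\<Sum>k>0. S\<^sub>k g ^ (k + n))\<close>,
  and summing the resulting recurrence for the coefficients of \<open>g ^ n\<close> over all coarsenings
  gives the same numbers \<open>avoiding_count n\<close>.
\<close>

section \<open>Pattern-avoiding representatives\<close>

lemma sylvester_Cons: "sylvester u w \<Longrightarrow> sylvester (x # u) (x # w)"
  using sylvester_append[OF sylvester_refl[of "[x]"]] by fastforce

lemma sylvester_count_list: "sylvester u w \<Longrightarrow> count_list u x = count_list w x"
  by (induction rule: sylvester.induct) auto

text \<open>The letter \<open>c\<close> passes the letters of \<open>L\<close> one at a time; the
  final \<open>b\<close> serves as the witness of the generating relation for every such
  exchange.\<close>

lemma sylvester_move:
  assumes "\<forall>a\<in>set L. a \<le> b" "b < c"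
  shows "sylvester (c # L @ v @ [b]) (L @ c # v @ [b])"
  using assms(1)
proof (induction L)
  case Nil
  then show ?case by (simp add: sylvester_refl)
next
  case (Cons a L)
  have "sylvester ([c, a] @ (L @ v) @ [b]) ([a, c] @ (L @ v) @ [b])"
    using Cons.prems assms(2) by (intro sylvester_sym[OF sylvester_gen]) auto
  moreover have "sylvester (a # c # L @ v @ [b]) (a # L @ c # v @ [b])"
    using Cons by (intro sylvester_Cons) auto
  ultimately show ?case
    by (auto intro: sylvester_trans)
qed

text \<open>Letters greater than \<open>b\<close> are moved behind the smaller ones by
  \<open>sylvester_move\<close>, with the last letter \<open>b\<close> as witness. This separates
  the two subtrees below the root \<open>b\<close>.\<close>

lemma sylvester_partition:
  "sylvester (w @ [b]) (filter (\<lambda>x. x \<le> b) w @ filter (\<lambda>x. b < x) w @ [b])"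
proof (induction w)
  case Nil
  then show ?case by (simp add: sylvester_refl)
next
  case (Cons c w)
  show ?case
  proof (cases "c \<le> b")
    case True
    then show ?thesis using sylvester_Cons[OF Cons] by (simp add: leD)
  next
    case False
    then have "sylvester (c # filter (\<lambda>x. x \<le> b) w @ filter (\<lambda>x. b < x) w @ [b])
        (filter (\<lambda>x. x \<le> b) w @ c # filter (\<lambda>x. b < x) w @ [b])"
      by (intro sylvester_move) auto
    then show ?thesis
      using sylvester_trans[OF sylvester_Cons[OF Cons]] False by simp
  qed
qed

text \<open>Postorder reading of the binary search tree obtained by inserting the letters from right
  to left: the last letter is the root, letters equal to it go left.\<close>

function sylv_nf :: "'a::linorder list \<Rightarrow> 'a list" where
  "sylv_nf [] = []"
| "sylv_nf (w @ [b]) = sylv_nf (filter (\<lambda>x. x \<le> b) w) @ sylv_nf (filter (\<lambda>x. b < x) w) @ [b]"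
  by (metis rev_exhaust) auto
termination
  by (relation "measure length") (auto simp: le_imp_less_Suc)

lemma sylvester_sylv_nf: "sylvester w (sylv_nf w)"
proof (induction w rule: sylv_nf.induct)
  case 1
  then show ?case by (simp add: sylvester_refl)
next
  case (2 w b)
  then have "sylvester (filter (\<lambda>x. x \<le> b) w @ filter (\<lambda>x. b < x) w @ [b]) (sylv_nf (w @ [b]))"
    by (auto intro!: sylvester_append sylvester_refl)
  then show ?case using sylvester_partition sylvester_trans by blast
qed

text \<open>If \<open>b\<close> is the last letter, \<open>a\<close> and \<open>c\<close> fall into
  different filters and their order is lost. Otherwise one splits at the last letter
  \<open>d\<close>: either at most one of \<open>a\<close>, \<open>c\<close> survives a filter, or
  both do, and then so does \<open>b\<close>, as it lies between them; the induction hypothesis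
  applies to this shorter instance.\<close>

lemma sylv_nf_gen:
  assumes "a \<le> b" "b < c"
  shows "sylv_nf (x @ [a, c] @ v @ [b] @ y) = sylv_nf (x @ [c, a] @ v @ [b] @ y)"
proof (induction "length (x @ v @ y)" arbitrary: x v y rule: less_induct)
  case less
  show ?case
  proof (cases y rule: rev_cases)
    case Nil
    have "sylv_nf ((x @ [a, c] @ v) @ [b]) = sylv_nf ((x @ [c, a] @ v) @ [b])"
      using assms by (simp only: sylv_nf.simps) auto
    then show ?thesis using Nil by simp
  next
    case (snoc y' d)
    have IH: "sylv_nf (filter P (x @ [a, c] @ v @ [b] @ y')) = sylv_nf (filter P (x @ [c, a] @ v @ [b] @ y'))"
      if "\<not> (P a \<and> P c) \<or> P b" for P
    proof (cases "P a \<and> P c")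
      case True
      have "length (filter P x @ filter P v @ filter P y') < length (x @ v @ y)"
        using snoc by (simp add: add_mono le_imp_less_Suc)
      from less[OF this] show ?thesis using True that by simp
    qed auto
    have "sylv_nf ((x @ [a, c] @ v @ [b] @ y') @ [d]) = sylv_nf ((x @ [c, a] @ v @ [b] @ y') @ [d])"
      unfolding sylv_nf.simps using assms by (intro arg_cong2[of _ _ _ _ "(@)"] IH refl) auto
    then show ?thesis using snoc by simp
  qed
qed

lemma sylvester_imp_sylv_nf_eq:
  assumes "sylvester u w"
  shows "sylv_nf u = sylv_nf w"
proof -
  \<comment> \<open>Arbitrary contexts let the product case replace its two factors one after the
    other.\<close>
  have "sylv_nf (x @ u @ y) = sylv_nf (x @ w @ y)" for x y
    using assms
  proof (induction arbitrary: x y rule: sylvester.induct)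
    case (sylvester_gen a b c v)
    then show ?case using sylv_nf_gen[of a b c x v y] by simp
  next
    case (sylvester_append u u' w w')
    then show ?case by (metis append.assoc)
  qed auto
  from this[of "[]" "[]"] show ?thesis by simp
qed

text \<open>Strict decrease of the later letters below \<open>c\<close> says that no subsequence c,
  a, b with \<open>a \<le> b < c\<close> starts at \<open>c\<close>.\<close>

fun avoiding :: "'a::linorder list \<Rightarrow> bool" where
  "avoiding [] = True"
| "avoiding (c # w) \<longleftrightarrow> sorted_wrt (>) (filter (\<lambda>x. x < c) w) \<and> avoiding w"

lemma avoiding_filter: "avoiding w \<Longrightarrow> avoiding (filter P w)"
proof (induction w)
  case (Cons c w)
  have "filter (\<lambda>x. x < c) (filter P w) = filter P (filter (\<lambda>x. x < c) w)"
    by (simp add: conj_commute)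
  then have "sorted_wrt (>) (filter (\<lambda>x. x < c) (filter P w))"
    using Cons.prems sorted_wrt_filter by fastforce
  then show ?case using Cons by simp
qed simp

lemma avoiding_snoc_greater:
  "avoiding w \<Longrightarrow> \<forall>x\<in>set w. b < x \<Longrightarrow> avoiding (w @ [b])"
  by (induction w) (auto simp: sorted_wrt_append)

lemma avoiding_append_le:
  assumes "avoiding u" "avoiding w" "\<forall>x\<in>set u. \<forall>y\<in>set w. x \<le> y"
  shows "avoiding (u @ w)"
  using assms
proof (induction u)
  case (Cons c u)
  then have "filter (\<lambda>x. x < c) w = []"
    by (auto simp: filter_empty_conv not_less)
  with Cons show ?case by simp
qed simp

lemma avoiding_sylv_nf: "avoiding (sylv_nf w)"
proof (induction w rule: sylv_nf.induct)
  case (2 w b)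
  have set_nf: "set (sylv_nf u) = set u" for u :: "'a list"
    using sylvester_count_list[OF sylvester_sylv_nf[of u]] by (metis count_list_0_iff subsetI subset_antisym)
  show ?case
    unfolding sylv_nf.simps
    by (intro avoiding_append_le avoiding_snoc_greater 2) (auto simp: set_nf)
qed simp

text \<open>A letter \<open>c > b\<close> followed by some \<open>x \<le> b\<close> would form the
  forbidden pattern c, x, b with the final \<open>b\<close>. Hence once a letter exceeds
  \<open>b\<close>, all later letters of \<open>w\<close> do.\<close>

lemma avoiding_snoc_partition:
  "avoiding (w @ [b]) \<Longrightarrow> filter (\<lambda>x. x \<le> b) w @ filter (\<lambda>x. b < x) w = w"
proof (induction w)
  case (Cons c w)
  show ?case
  proof (cases "c \<le> b")
    case False
    then have "\<forall>x\<in>set w. b < x"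
      using Cons.prems by (auto simp: sorted_wrt_append)
    then have "filter (\<lambda>x. x \<le> b) w = []" "filter (\<lambda>x. b < x) w = w"
      by (auto simp: filter_empty_conv not_le)
    then show ?thesis using False by simp
  qed (use Cons in \<open>simp add: leD\<close>)
qed simp

lemma avoiding_appendD: "avoiding (u @ w) \<Longrightarrow> avoiding u"
  by (induction u) (auto simp: sorted_wrt_append)

lemma sylv_nf_avoiding: "avoiding w \<Longrightarrow> sylv_nf w = w"
proof (induction w rule: sylv_nf.induct)
  case (2 w b)
  have "avoiding (filter P w)" for P
    using avoiding_filter avoiding_appendD 2(3) by blast
  then show ?case using 2 avoiding_snoc_partition[OF 2(3)] by simp
qed simp

section \<open>Classes and their representatives\<close>

lemma has_evaluation_sylvester:
  assumes "sylvester u w"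
  shows "has_evaluation u I \<longleftrightarrow> has_evaluation w I"
proof -
  have "count_list u x = count_list w x" for x
    by (rule sylvester_count_list[OF assms])
  moreover from this have "set u = set w"
    by (metis count_list_0_iff subsetI subset_antisym)
  ultimately show ?thesis by (simp add: has_evaluation_def)
qed

lemma card_sylvester_classes:
  "card (sylvester_classes I) = card {w. has_evaluation w I \<and> avoiding w}"
proof -
  define cl where "cl = (\<lambda>w :: nat list. {(u, w). sylvester u w} `` {w})"
  have cl_eq: "cl u = cl w \<longleftrightarrow> sylvester u w" for u w
    unfolding cl_def using sylvester_refl sylvester_sym sylvester_trans by blast
  have "sylvester_classes I = cl ` {w. has_evaluation w I}"
    by (auto simp: sylvester_classes_def quotient_def cl_def)
  also have "\<dots> = cl ` {w. has_evaluation w I \<and> avoiding w}"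
  proof (intro equalityI subsetI)
    fix X assume "X \<in> cl ` {w. has_evaluation w I}"
    then obtain w where "X = cl w" "has_evaluation w I" by blast
    then show "X \<in> cl ` {w. has_evaluation w I \<and> avoiding w}"
      using sylvester_sylv_nf[of w] has_evaluation_sylvester avoiding_sylv_nf cl_eq
      by (intro image_eqI[of _ _ "sylv_nf w"]) auto
  qed auto
  \<comment> \<open>Congruent avoiding words share a normal form, and each is its own normal form,
    so they are equal.\<close>
  also have "card \<dots> = card {w. has_evaluation w I \<and> avoiding w}"
    by (intro card_image inj_onI)
      (metis (mono_tags) cl_eq mem_Collect_eq sylv_nf_avoiding sylvester_imp_sylv_nf_eq)
  finally show ?thesis .
qed

section \<open>Counting avoiding words\<close>

text \<open>Evaluation shifted to start at letter \<open>s\<close>, in a recursive form that strips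
  the least letter, as the insertion argument requires.\<close>

fun words :: "nat \<Rightarrow> nat list \<Rightarrow> nat list set" where
  "words s [] = {[]}"
| "words s (i # I) = {w. count_list w s = i \<and> filter (\<lambda>x. x \<noteq> s) w \<in> words (Suc s) I}"

lemma words_ge: "w \<in> words s I \<Longrightarrow> x \<in> set w \<Longrightarrow> s \<le> x"
proof (induction I arbitrary: s w)
  case (Cons i I)
  show ?case
  proof (cases "x = s")
    case False
    then have "x \<in> set (filter (\<lambda>x. x \<noteq> s) w)" using Cons.prems by simp
    then show ?thesis using Cons by fastforce
  qed simp
qed simp

lemma count_list_filter: "count_list (filter P w) x = (if P x then count_list w x else 0)"
  by (induction w) auto

lemma words_iff:
  "w \<in> words s I \<longleftrightarrow> set w \<subseteq> {s..<s + length I} \<and> (\<forall>k<length I. count_list w (s + k) = I ! k)"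
proof (induction I arbitrary: s w)
  case (Cons i I)
  have "set (filter (\<lambda>x. x \<noteq> s) w) \<subseteq> {Suc s..<Suc s + length I} \<longleftrightarrow>
      set w \<subseteq> {s..<s + length (i # I)}"
  proof -
    have "set (filter (\<lambda>x. x \<noteq> s) w) = set w - {s}" by auto
    moreover have "{s..<s + length (i # I)} = insert s {Suc s..<Suc s + length I}" by auto
    ultimately show ?thesis by blast
  qed
  moreover have "(\<forall>k<length (i # I). count_list w (s + k) = (i # I) ! k) \<longleftrightarrow>
      count_list w s = i \<and> (\<forall>k<length I. count_list (filter (\<lambda>x. x \<noteq> s) w) (Suc s + k) = I ! k)"
    by (simp add: All_less_Suc2 count_list_filter)
  ultimately show ?case
    by (simp only: words.simps mem_Collect_eq Cons) blast
qed simp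

lemma has_evaluation_iff_words: "has_evaluation w I \<longleftrightarrow> w \<in> words 1 I"
proof -
  have "{1..length I} = Suc ` {..<length I}" "{1..length I} = {1..<1 + length I}"
    by (auto simp: image_Suc_lessThan)
  then have "(\<forall>k\<in>{1..length I}. count_list w k = I ! (k - 1)) \<longleftrightarrow>
      (\<forall>k<length I. count_list w (1 + k) = I ! k)"
    by (simp only: ball_simps) auto
  with \<open>{1..length I} = {1..<1 + length I}\<close> show ?thesis
    unfolding has_evaluation_def words_iff by (simp only:)
qed

section \<open>Cuts and insertion of the least letter\<close>

definition cuts :: "'a::linorder list \<Rightarrow> nat set" where
  "cuts u = {n. n \<le> length u \<and> (\<forall>p\<in>set (take n u). \<forall>q\<in>set (drop n u). p \<le> q)}"

lemma finite_cuts: "finite (cuts u)"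
  by (rule finite_subset[of _ "{..length u}"]) (auto simp: cuts_def)

text \<open>The parameter \<open>i\<close> does not count the copy of \<open>a\<close> at the cut: \<open>i + 1\<close> copies are inserted.\<close>

definition insert_min :: "'a \<Rightarrow> nat \<Rightarrow> 'a list \<Rightarrow> nat \<Rightarrow> 'a list" where
  "insert_min a i u n = replicate i a @ take n u @ a # drop n u"

text \<open>For a letter \<open>c\<close> before the cut, no letter after the cut is below
  \<open>c\<close>, so the inserted \<open>a\<close> ends the list of smaller letters after
  \<open>c\<close> and is less than all of them. The leading copies are minimal and start no
  pattern.\<close>

lemma avoiding_insert_min:
  assumes "avoiding u" "\<forall>x\<in>set u. a < x" "n \<in> cuts u"
  shows "avoiding (insert_min a i u n)"
proof -
  define x y where "x = take n u" and "y = drop n u"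
  have "avoiding (x @ y)" "\<forall>p\<in>set (x @ y). a < p" "\<forall>p\<in>set x. \<forall>q\<in>set y. p \<le> q"
    using assms unfolding x_def y_def append_take_drop_id by (auto simp: cuts_def)
  then have "avoiding (x @ a # y)"
  proof (induction x)
    case (Cons c x)
    then have "filter (\<lambda>p. p < c) y = []"
      by (auto simp: filter_empty_conv not_less)
    with Cons show ?case by (auto simp: sorted_wrt_append)
  next
    case Nil
    then have "filter (\<lambda>p. p < a) y = []"
      by (auto simp: filter_empty_conv)
    with Nil show ?case by simp
  qed
  moreover have "\<forall>p\<in>set (x @ a # y). a \<le> p"
    using \<open>\<forall>p\<in>set (x @ y). a < p\<close> by (auto simp: less_imp_le)
  moreover have "avoiding (replicate i a)"
    by (induction i) auto
  ultimately have "avoiding (replicate i a @ x @ a # y)"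
    by (intro avoiding_append_le[of "replicate i a"]) (assumption, assumption, auto)
  then show ?thesis by (simp add: insert_min_def x_def y_def)
qed

lemma insert_min_surj:
  assumes "avoiding w" "\<forall>x\<in>set w. a \<le> x" "count_list w a = Suc i"
  defines "u \<equiv> filter (\<lambda>x. x \<noteq> a) w"
  shows "\<exists>n\<in>cuts u. w = insert_min a i u n"
proof -
  have "a \<in> set w" using assms(3) by (metis count_notin nat.distinct(1))
  then obtain p y where w: "w = p @ a # y" "a \<notin> set y"
    using split_list_last by metis
  \<comment> \<open>A letter \<open>c > a\<close> before a copy of \<open>a\<close> in
    \<open>p\<close> would form the pattern c, a, a with the last \<open>a\<close> of
    \<open>w\<close>.\<close>
  have "p = replicate (count_list p a) a @ filter (\<lambda>x. x \<noteq> a) p"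
    using assms(1,2) unfolding w
  proof (induction p)
    case (Cons c p)
    show ?case
    proof (cases "c = a")
      case False
      then have "a < c" using Cons.prems by auto
      then have "a \<notin> set p"
        using Cons.prems by (auto simp: sorted_wrt_append)
      then have "filter (\<lambda>x. x \<noteq> a) p = p" by (auto simp: filter_id_conv)
      then show ?thesis using False \<open>a \<notin> set p\<close> by simp
    qed (use Cons in simp)
  qed simp
  moreover define x where "x = filter (\<lambda>x. x \<noteq> a) p"
  moreover have "count_list p a = i" using assms(3) w by simp
  ultimately have w': "w = replicate i a @ x @ a # y" using w by simp
  \<comment> \<open>Otherwise \<open>c\<close>, the last \<open>a\<close> and \<open>b\<close> would
    form the forbidden pattern.\<close>
  have "\<forall>c\<in>set x. \<forall>b\<in>set y. c \<le> b"
  proof (intro ballI)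
    fix c b assume cb: "c \<in> set x" "b \<in> set y"
    have "avoiding (p @ a # y) \<Longrightarrow> c \<in> set p \<Longrightarrow> b \<in> set y \<Longrightarrow> a < c \<Longrightarrow> a \<le> b \<Longrightarrow> c \<le> b" for p
      by (induction p) (auto simp: sorted_wrt_append not_le[symmetric])
    moreover have "c \<in> set p" "a < c" "a \<le> b"
      using cb assms(2) w by (auto simp: x_def order.strict_iff_order)
    ultimately show "c \<le> b" using assms(1) cb w by blast
  qed
  moreover have "u = x @ y"
    unfolding u_def w using w(2) by (auto simp: x_def filter_id_conv)
  ultimately have "length x \<in> cuts u" "w = insert_min a i u (length x)"
    by (auto simp: cuts_def insert_min_def w')
  then show ?thesis by blast
qed

lemma insert_min_inj:
  assumes "insert_min a i u n = insert_min a i u' n'" "a \<notin> set u" "a \<notin> set u'"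
    "n \<le> length u" "n' \<le> length u'"
  shows "u = u' \<and> n = n'"
proof -
  have "take n u @ a # drop n u = take n' u' @ a # drop n' u'"
    using assms(1) by (simp add: insert_min_def)
  moreover have "a \<notin> set (take n u)" "a \<notin> set (take n' u')"
    using assms by (auto dest: in_set_takeD)
  moreover have "takeWhile (\<lambda>z. z \<noteq> a) (x @ a # y) = x" if "a \<notin> set x" for x y
    using that by (induction x) auto
  ultimately have "take n u = take n' u'" "drop n u = drop n' u'"
    by (metis, metis append_same_eq same_append_eq list.inject)
  then show ?thesis
    using assms(4,5) by (metis append_take_drop_id length_take min.absorb2)
qed

text \<open>The \<open>Suc i\<close> positions up to the end of the leading copies are all cuts.
  Behind the second \<open>a\<close>-block, position \<open>Suc i + m\<close> is a cut exactly if
  \<open>m\<close> is one of \<open>u\<close>, since the added letters are minimal and lie in the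
  prefix.\<close>

lemma card_cuts_insert_min:
  assumes "\<forall>x\<in>set u. a < x" "n \<in> cuts u"
  shows "card (cuts (insert_min a i u n)) = Suc i + card {m \<in> cuts u. n \<le> m}"
proof -
  define w where "w = insert_min a i u n"
  have n: "n \<le> length u" using assms(2) by (simp add: cuts_def)
  have len: "length w = Suc i + length u" using n by (simp add: w_def insert_min_def)
  have "cuts w = {..<Suc i} \<union> (\<lambda>m. Suc i + m) ` {m \<in> cuts u. n \<le> m}"
  proof (intro set_eqI)
    fix k
    consider "k < Suc i" | "Suc i \<le> k" "k < Suc i + n" | m where "k = Suc i + m" "n \<le> m"
      by (metis le_Suc_ex le_add_diff_inverse nat_add_left_cancel_le not_le)
    then show "k \<in> cuts w \<longleftrightarrow> k \<in> {..<Suc i} \<union> (\<lambda>m. Suc i + m) ` {m \<in> cuts u. n \<le> m}"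
    proof cases
      case 1
      then have "set (take k w) \<subseteq> {a}" by (auto simp: w_def insert_min_def dest: in_set_takeD)
      moreover have "\<forall>q\<in>set (drop k w). a \<le> q"
        using assms(1)
        by (auto simp: w_def insert_min_def less_imp_le dest!: in_set_dropD in_set_takeD)
      ultimately show ?thesis using 1 len by (auto simp: cuts_def)
    next
      case 2
      then obtain j where j: "k = i + Suc j" "j < n"
        by (metis Suc_le_eq add_Suc add_Suc_right add_less_cancel_left le_Suc_ex)
      \<comment> \<open>Between the two blocks the first letter of \<open>u\<close>, which exceeds
        \<open>a\<close>, is already in the prefix while the last \<open>a\<close> is still
        ahead.\<close>
      then have "a \<in> set (drop k w)" "u ! 0 \<in> set (take k w)" "u ! 0 \<in> set u"
        using n by (cases u; auto simp: w_def insert_min_def take_Cons')+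
      then have "k \<notin> cuts w"
        using assms(1) by (force simp: cuts_def)
      then show ?thesis using 2 by auto
    next
      case 3
      have "drop k w = drop m u" "set (take k w) = insert a (set (take m u))"
        if m: "m \<le> length u"
      proof -
        obtain d where d: "m = n + d" using 3 le_Suc_ex by blast
        show "drop k w = drop m u"
          using 3 n d by (simp add: w_def insert_min_def add.commute)
        have "take k w = replicate i a @ take n u @ a # take d (drop n u)"
          using 3 n d by (simp add: w_def insert_min_def)
        then show "set (take k w) = insert a (set (take m u))"
          unfolding d take_add by auto
      qed
      then show ?thesis
        using 3 assms(1) len
        by (fastforce simp: cuts_def intro: less_imp_le dest: in_set_dropD)
    qed
  qed
  also have "card \<dots> = Suc i + card {m \<in> cuts u. n \<le> m}"
    by (subst card_Un_disjoint) (auto simp: finite_cuts card_image inj_on_def)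
  finally show ?thesis by (simp add: w_def)
qed

text \<open>Sending \<open>n\<close> to its rank from the top is a bijection from \<open>S\<close>
  onto \<open>{1..card S}\<close>.\<close>

lemma sum_card_ge:
  fixes S :: "'a::linorder set" and f :: "nat \<Rightarrow> 'b::comm_monoid_add"
  assumes "finite S"
  shows "(\<Sum>n\<in>S. f (card {m \<in> S. n \<le> m})) = (\<Sum>m=1..card S. f m)"
  using assms
proof (induction S rule: finite_linorder_min_induct)
  case (insert b S)
  have "b \<notin> S" using insert by auto
  have "{m \<in> insert b S. n \<le> m} = {m \<in> S. n \<le> m}" if "n \<in> S" for n
    using insert that by (auto simp: leD)
  moreover have "{m \<in> insert b S. b \<le> m} = insert b S"
    using insert by (auto simp: less_imp_le)
  ultimately have "(\<Sum>n\<in>insert b S. f (card {m \<in> insert b S. n \<le> m})) =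
      f (card (insert b S)) + (\<Sum>n\<in>S. f (card {m \<in> S. n \<le> m}))"
    using insert \<open>b \<notin> S\<close> by (simp cong: sum.cong)
  then show ?case using insert \<open>b \<notin> S\<close> by (simp add: add.commute)
qed simp

text \<open>For positive multiplicities \<open>K\<close> of the letters still to come, largest
  first, this is the number of avoiding extensions of one word with \<open>n\<close> cuts.\<close>

fun avoiding_count :: "nat \<Rightarrow> nat list \<Rightarrow> nat" where
  "avoiding_count n [] = 1"
| "avoiding_count n (k # K) = (\<Sum>m=1..n. avoiding_count (k + m) K)"

lemma avoiding_words_Cons:
  "{w \<in> words s (Suc i # I). avoiding w} =
    (\<lambda>(u, n). insert_min s i u n) ` (SIGMA u:{u \<in> words (Suc s) I. avoiding u}. cuts u)"
proof (intro equalityI subsetI)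
  fix w assume w: "w \<in> {w \<in> words s (Suc i # I). avoiding w}"
  define u where "u = filter (\<lambda>x. x \<noteq> s) w"
  have "\<forall>x\<in>set w. s \<le> x" using words_ge w by blast
  then obtain n where "n \<in> cuts u" "w = insert_min s i u n"
    unfolding u_def using w insert_min_surj[of w s i] by auto
  moreover have "u \<in> words (Suc s) I" "avoiding u"
    using w avoiding_filter by (auto simp: u_def)
  ultimately show "w \<in> (\<lambda>(u, n). insert_min s i u n) `
      (SIGMA u:{u \<in> words (Suc s) I. avoiding u}. cuts u)"
    by (intro image_eqI[of _ _ "(u, n)"]) auto
next
  fix w assume "w \<in> (\<lambda>(u, n). insert_min s i u n) `
      (SIGMA u:{u \<in> words (Suc s) I. avoiding u}. cuts u)"
  then obtain u n where u: "u \<in> words (Suc s) I" "avoiding u" "n \<in> cuts u"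
    and w: "w = insert_min s i u n" by auto
  have gt: "\<forall>x\<in>set u. s < x" using words_ge[OF u(1)] by (auto simp: Suc_le_eq)
  have "filter (\<lambda>x. x \<noteq> s) w = filter (\<lambda>x. x \<noteq> s) (take n u @ drop n u)"
    by (simp add: w insert_min_def del: append_take_drop_id)
  also have "\<dots> = u" using gt by (auto simp: filter_id_conv)
  finally have "filter (\<lambda>x. x \<noteq> s) w = u" .
  moreover have "count_list w s = Suc i + count_list (take n u @ drop n u) s"
    by (simp add: w insert_min_def del: append_take_drop_id) (induction i, auto)
  then have "count_list w s = Suc i" using gt by (auto simp: count_list_0_iff)
  ultimately show "w \<in> {w \<in> words s (Suc i # I). avoiding w}"
    using u gt avoiding_insert_min by (auto simp: w)
qed

text \<open>The induction strips the least letter, which \<open>avoiding_count\<close> handles last;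
  the weight with arbitrary \<open>K\<close> absorbs this letter. The start value 1 is the number of
  cuts of the empty word.\<close>

lemma sum_avoiding_words:
  assumes "composition I"
  shows "finite {w \<in> words s I. avoiding w} \<and>
    (\<Sum>w\<in>{w \<in> words s I. avoiding w}. avoiding_count (card (cuts w)) K) = avoiding_count 1 (rev I @ K)"
  using assms
proof (induction I arbitrary: s K)
  case Nil
  have "{w \<in> words s []. avoiding w} = {[]}" by auto
  moreover have "cuts ([] :: nat list) = {0}" by (auto simp: cuts_def)
  ultimately show ?case by simp
next
  case (Cons k I)
  then obtain i where k: "k = Suc i" by (cases k) (auto simp: composition_def)
  have I: "composition I" using Cons.prems by (simp add: composition_def)
  define U where "U = {u \<in> words (Suc s) I. avoiding u}"
  have U: "finite U" "(\<Sum>u\<in>U. avoiding_count (card (cuts u)) K') = avoiding_count 1 (rev I @ K')" for K'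
    using Cons.IH[OF I] by (auto simp: U_def)
  have gt: "\<forall>x\<in>set u. s < x" if "u \<in> U" for u
    using words_ge[of u "Suc s" I] that by (auto simp: U_def Suc_le_eq)
  have inj: "inj_on (\<lambda>(u, n). insert_min s i u n) (SIGMA u:U. cuts u)"
  proof (rule inj_onI, clarify)
    fix u n u' n' assume *: "u \<in> U" "n \<in> cuts u" "u' \<in> U" "n' \<in> cuts u'"
      "insert_min s i u n = insert_min s i u' n'"
    then show "u = u' \<and> n = n'"
      using gt by (intro insert_min_inj[OF *(5)]) (auto simp: cuts_def)
  qed
  have "(\<Sum>w\<in>{w \<in> words s (k # I). avoiding w}. avoiding_count (card (cuts w)) K) =
      (\<Sum>(u, n)\<in>(SIGMA u:U. cuts u). avoiding_count (card (cuts (insert_min s i u n))) K)"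
    unfolding k avoiding_words_Cons U_def[symmetric]
    by (subst sum.reindex[OF inj]) (simp add: case_prod_unfold)
  also have "\<dots> = (\<Sum>u\<in>U. \<Sum>n\<in>cuts u. avoiding_count (card (cuts (insert_min s i u n))) K)"
    by (subst sum.Sigma) (auto simp: U finite_cuts)
  also have "\<dots> = (\<Sum>u\<in>U. \<Sum>n\<in>cuts u. avoiding_count (k + card {m \<in> cuts u. n \<le> m}) K)"
    using gt by (intro sum.cong refl) (simp add: card_cuts_insert_min k)
  also have "\<dots> = (\<Sum>u\<in>U. \<Sum>m=1..card (cuts u). avoiding_count (k + m) K)"
    by (intro sum.cong refl sum_card_ge finite_cuts)
  also have "\<dots> = avoiding_count 1 (rev (k # I) @ K)"
    using U(2)[of "k # K"] by simp
  finally show ?case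
    unfolding k avoiding_words_Cons U_def[symmetric] using U(1) by (simp add: finite_cuts)
qed

section \<open>The series \<open>g\<close> summed over coarsenings\<close>

lemma g_series:
  "nsym_sums (\<lambda>n. sym_S n * g_series ^ n) (g_series :: 'a::comm_ring_1 nsym)"
  unfolding g_series_def by (rule theI'[OF g_series_ex1])

lemma g_power_Nil: "nsym_coeff ((g_series :: 'a::comm_ring_1 nsym) ^ n) [] = 1"
proof -
  have "nsym_coeff (g_series :: 'a nsym) [] = 1"
    using g_series nsym_sums_iff by blast
  then show ?thesis by (induction n) (simp_all add: nsym_coeff_times nsym_coeff_one)
qed

text \<open>In \<open>g * g ^ n\<close> the constant term of the first factor contributes the
  coefficient of \<open>g ^ n\<close>. By the functional equation the other terms sum to a
  coefficient of \<open>g ^ k * g ^ n\<close>.\<close>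

lemma g_power_Suc_Cons:
  assumes "k > 0"
  shows "nsym_coeff ((g_series :: 'a::comm_ring_1 nsym) ^ Suc n) (k # K) =
    nsym_coeff (g_series ^ n) (k # K) + nsym_coeff (g_series ^ (n + k) :: 'a nsym) K"
proof -
  have "nsym_coeff (g_series :: 'a nsym) [] = 1"
    and "nsym_coeff (g_series :: 'a nsym) (k # L) = nsym_coeff (g_series ^ k) L" for L
    using g_series assms nsym_sums_iff by blast+
  then have "nsym_coeff ((g_series :: 'a nsym) ^ Suc n) (k # K) =
      nsym_coeff (g_series ^ n) (k # K) + nsym_coeff (g_series ^ k * g_series ^ n :: 'a nsym) K"
    by (simp add: nsym_coeff_times sum.atMost_Suc_shift del: sum.atMost_Suc)
  then show ?thesis by (simp add: power_add[symmetric] add.commute)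
qed

lemma g_power_Cons:
  assumes "k > 0"
  shows "nsym_coeff ((g_series :: 'a::comm_ring_1 nsym) ^ n) (k # K) =
    (\<Sum>m<n. nsym_coeff (g_series ^ (m + k) :: 'a nsym) K)"
  by (induction n) (simp_all add: nsym_coeff_one g_power_Suc_Cons[OF assms] del: power_Suc)

section \<open>Recursive structure of coarsenings\<close>

lemma coarser_Nil: "coarser J [] \<longleftrightarrow> J = []"
  unfolding coarser_def by (auto simp: neq_Nil_conv) (metis list.set_intros(1) neq_Nil_conv)

text \<open>Here \<open>C\<close> is the rest of the first block after \<open>k\<close>, possibly
  empty.\<close>

lemma coarser_Cons:
  "coarser J (k # K) \<longleftrightarrow>
    (\<exists>C Bs. [] \<notin> set Bs \<and> C @ concat Bs = K \<and> J = (k + sum_list C) # map sum_list Bs)"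
proof
  assume "coarser J (k # K)"
  then obtain Bs where Bs: "[] \<notin> set Bs" "concat Bs = k # K" "J = map sum_list Bs"
    unfolding coarser_def by blast
  then obtain C Bs' where "Bs = C # Bs'" "C \<noteq> []" by (cases Bs) auto
  then obtain C' where "Bs = (k # C') # Bs'" "K = C' @ concat Bs'" using Bs by (cases C) auto
  then show "\<exists>C Bs. [] \<notin> set Bs \<and> C @ concat Bs = K \<and> J = (k + sum_list C) # map sum_list Bs"
    using Bs by (intro exI[of _ C'] exI[of _ Bs']) auto
next
  assume "\<exists>C Bs. [] \<notin> set Bs \<and> C @ concat Bs = K \<and> J = (k + sum_list C) # map sum_list Bs"
  then obtain C Bs where "[] \<notin> set Bs" "C @ concat Bs = K" "J = (k + sum_list C) # map sum_list Bs"
    by blast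
  then show "coarser J (k # K)"
    unfolding coarser_def by (intro exI[of _ "(k # C) # Bs"]) auto
qed

lemma coarser_single: "coarser J [k] \<longleftrightarrow> J = [k]"
proof -
  have "(C @ concat Bs = [] \<and> [] \<notin> set Bs) \<longleftrightarrow> C = [] \<and> Bs = []" for C :: "nat list" and Bs
    by (cases Bs) auto
  then show ?thesis unfolding coarser_Cons by auto
qed

text \<open>The two alternatives are that the first block is \<open>[k]\<close> alone or that it
  also contains \<open>l\<close>.\<close>

lemma coarser_Cons_Cons:
  "coarser J (k # l # K) \<longleftrightarrow> (\<exists>J'. coarser J' (l # K) \<and> J = k # J') \<or> coarser J ((k + l) # K)"
proof
  assume "coarser J (k # l # K)"
  then obtain C Bs where *: "[] \<notin> set Bs" "C @ concat Bs = l # K"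
    "J = (k + sum_list C) # map sum_list Bs"
    unfolding coarser_Cons by blast
  show "(\<exists>J'. coarser J' (l # K) \<and> J = k # J') \<or> coarser J ((k + l) # K)"
  proof (cases C)
    case Nil
    then show ?thesis using * unfolding coarser_def by auto
  next
    case (Cons c C')
    then have "coarser J ((k + l) # K)"
      using * unfolding coarser_Cons by (intro exI[of _ C'] exI[of _ Bs]) auto
    then show ?thesis ..
  qed
next
  assume "(\<exists>J'. coarser J' (l # K) \<and> J = k # J') \<or> coarser J ((k + l) # K)"
  then show "coarser J (k # l # K)"
  proof
    assume "\<exists>J'. coarser J' (l # K) \<and> J = k # J'"
    then obtain Bs where "[] \<notin> set Bs" "concat Bs = l # K" "J = k # map sum_list Bs"
      unfolding coarser_def by blast
    then show ?thesis
      unfolding coarser_Cons by (intro exI[of _ "[]"] exI[of _ Bs]) auto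
  next
    assume "coarser J ((k + l) # K)"
    then obtain C Bs where "[] \<notin> set Bs" "C @ concat Bs = K"
      "J = (k + l + sum_list C) # map sum_list Bs"
      unfolding coarser_Cons by blast
    then show ?thesis
      unfolding coarser_Cons by (intro exI[of _ "l # C"] exI[of _ Bs]) auto
  qed
qed

lemma coarser_Cons_hd: "coarser J (k # K) \<Longrightarrow> \<exists>j J'. J = j # J' \<and> k \<le> j"
  by (auto simp: coarser_Cons)

lemma composition_coarser:
  assumes "coarser J L" "composition L"
  shows "composition J"
proof -
  obtain Bs where Bs: "[] \<notin> set Bs" "concat Bs = L" "J = map sum_list Bs"
    using assms(1) unfolding coarser_def by blast
  have "0 < sum_list C" if "C \<in> set Bs" for C
  proof -
    have "C \<noteq> []" "\<forall>c\<in>set C. 0 < c"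
      using that Bs(1,2) assms(2) by (auto simp: composition_def)
    then show ?thesis by (cases C) auto
  qed
  then show ?thesis using Bs(3) by (simp add: composition_def)
qed

text \<open>The defining sum over \<open>1..k + n\<close> is cut after \<open>k\<close>; in the
  tail, \<open>l + (k + m)\<close> is read as \<open>(k + l) + m\<close>.\<close>

lemma avoiding_count_merge:
  "avoiding_count (k + n) (l # K) =
    avoiding_count k (l # K) + avoiding_count n ((k + l) # K)"
  by (induction n) (simp_all add: ac_simps)

text \<open>Either \<open>k\<close> stays a separate part or it is merged with \<open>l\<close>;
  both cases lead to shorter compositions. The two resulting sums are recombined by
  \<open>avoiding_count_merge\<close>.\<close>

lemma sum_g_power_coarser:
  assumes "composition L"
  shows "(\<Sum>J | coarser J L. nsym_coeff ((g_series :: 'a::comm_ring_1 nsym) ^ n) J) = of_nat (avoiding_count n L)"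
  using assms
proof (induction "length L" arbitrary: L n rule: less_induct)
  case less
  let ?c = "\<lambda>n. nsym_coeff ((g_series :: 'a nsym) ^ n)"
  consider "L = []" | k where "L = [k]" | k l K where "L = k # l # K"
    by (metis list.exhaust)
  then show ?case
  proof cases
    case 1
    then show ?thesis by (simp add: coarser_Nil g_power_Nil)
  next
    case 2
    then show ?thesis
      using less.prems by (simp add: coarser_single g_power_Cons g_power_Nil composition_def)
  next
    case 3
    have pos: "k > 0" "l > 0" "composition (l # K)" "composition ((k + l) # K)"
      using less.prems 3 by (auto simp: composition_def)
    have "{J. coarser J L} = (#) k ` {J. coarser J (l # K)} \<union> {J. coarser J ((k + l) # K)}"
      unfolding 3 coarser_Cons_Cons by auto
    \<comment> \<open>The first part is \<open>k\<close> in one set and at least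
      \<open>k + l > k\<close> in the other.\<close>
    moreover have "(#) k ` {J. coarser J (l # K)} \<inter> {J. coarser J ((k + l) # K)} = {}"
      using pos by (auto dest: coarser_Cons_hd)
    ultimately have "(\<Sum>J | coarser J L. ?c n J) =
        (\<Sum>J | coarser J (l # K). ?c n (k # J)) + (\<Sum>J | coarser J ((k + l) # K). ?c n J)"
      by (simp add: sum.union_disjoint finite_coarser sum.reindex)
    also have "(\<Sum>J | coarser J (l # K). ?c n (k # J)) = (\<Sum>m<n. \<Sum>J | coarser J (l # K). ?c (m + k) J)"
      unfolding g_power_Cons[OF pos(1)] by (rule sum.swap)
    also have "\<dots> = (\<Sum>m<n. of_nat (avoiding_count (m + k) (l # K)))"
      using pos 3 by (intro sum.cong refl less) auto
    also have "(\<Sum>J | coarser J ((k + l) # K). ?c n J) = of_nat (avoiding_count n ((k + l) # K))"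
      using pos 3 by (intro less) auto
    also have "(\<Sum>m<n. of_nat (avoiding_count (m + k) (l # K))) + of_nat (avoiding_count n ((k + l) # K)) =
        (of_nat (avoiding_count n L) :: 'a)"
    proof -
      \<comment> \<open>Both sides are the sum over \<open>m\<close> from 0 to \<open>n\<close>;
        this shifts the range \<open>m < n\<close> coming from powers of \<open>g\<close> to the
        range \<open>1..n\<close> of \<open>avoiding_count\<close>.\<close>
      have "(\<Sum>m<n. avoiding_count (m + k) (l # K)) + avoiding_count (n + k) (l # K) =
          avoiding_count k (l # K) + (\<Sum>m=1..n. avoiding_count (k + m) (l # K))"
        by (induction n) (auto simp: add.commute simp del: avoiding_count.simps)
      then have "(\<Sum>m<n. avoiding_count (m + k) (l # K)) + avoiding_count n ((k + l) # K) = avoiding_count n L"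
        unfolding 3 avoiding_count.simps(2)[of n k] add.commute[of n k]
        by (simp only: avoiding_count_merge[of k n l K])
      then show ?thesis by (metis of_nat_add of_nat_sum)
    qed
    finally show ?thesis .
  qed
qed

theorem theorem2p2:
  fixes I :: "nat list"
  assumes "composition I"
  shows "of_nat (card (sylvester_classes I)) =
    (\<Sum>J | coarser J (rev I).
       bracket (monomial_qsym J) (g_series :: 'a::{comm_ring_1, ring_char_0} nsym))"
proof -
  have rev: "composition (rev I)" using assms by (simp add: composition_def)
  \<comment> \<open>For \<open>K = []\<close> every weight is 1, so the weighted sum is a
    cardinality.\<close>
  have "card (sylvester_classes I) = avoiding_count 1 (rev I)"
    using sum_avoiding_words[OF assms, of 1 "[]"]
    by (simp add: card_sylvester_classes has_evaluation_iff_words)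
  then have "of_nat (card (sylvester_classes I)) =
      (\<Sum>J | coarser J (rev I). nsym_coeff ((g_series :: 'a nsym) ^ 1) J)"
    by (simp only: sum_g_power_coarser[OF rev])
  also have "\<dots> = (\<Sum>J | coarser J (rev I). bracket (monomial_qsym J) (g_series :: 'a nsym))"
    by (intro sum.cong refl) (simp add: bracket_monomial_qsym composition_coarser[OF _ rev])
  finally show ?thesis .
qed

end
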